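(* Let $K$ be a field, let $r,s\ge 1$ be integers, $A=K[x_1,\ldots,x_r]$, $B=K[x_{r+1},\ldots,x_{r+s}]$ and $R=K[x_1,\ldots,x_{r+s}]$. Let $I\subset A$ and $J\subset B$ be nonzero proper monomial ideals. Then for all integers $n\ge 0$, $$\operatorname{sdepth}_R((I+J)^n)\ \ge\ \min\big(\{\operatorname{sdepth}_R(I^n)\}\cup\{\operatorname{sdepth}_R(I^{n-i}J^i/I^{n-i+1}J^i): 1\le i\le n\}\big).$$
   Context: The symbols $I$, $J$ also denote the extended ideals $IR$, $JR$ in $R$; all sums, products and powers of ideals in the claim are taken in $R$. The zeroth power of an ideal is the whole ring. Stanley depth: let $S$ be a polynomial ring over $K$ in $N$ variables $x_1,\ldots,x_N$ and let $M$ be a finitely generated $\mathbb Z^N$-graded $S$-module. A Stanley decomposition of $M$ is a finite direct sum decomposition $\mathcal D: M=\bigoplus_{i=1}^{q} m_iK[Z_i]$ as a $\mathbb Z^N$-graded $K$-vector space, where each $m_i\in M$ is homogeneous, $Z_i\subset\{x_1,\ldots,x_N\}$, and $m_iK[Z_i]=\{um_i: u\in K[Z_i]\}$ is a free $K[Z_i]$-submodule of $M$. Put $\operatorname{sdepth}(\mathcal D)=\min_i|Z_i|$ and let $\operatorname{sdepth}_S(M)$ be the maximum of $\operatorname{sdepth}(\mathcal D)$ over all Stanley decompositions $\mathcal D$ of $M$. *)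

theory Defs
  imports
    "HOL-Library.Poly_Mapping"
    "HOL-Algebra.Ideal_Product"
    "HOL-Algebra.Module"
begin

text \<open>
  All polynomials live in the type \<open>(nat \<Rightarrow>\<^sub>0 nat) \<Rightarrow>\<^sub>0 'k\<close>: finitely supported maps from exponent
  vectors to coefficients, multiplied by convolution; the variables are \<open>x\<^sub>v\<close> for \<open>v :: nat\<close>.
  The polynomial ring over \<open>'k\<close> in the variables \<open>x\<^sub>v\<close> with \<open>v \<in> V\<close> is a carrier in this type, so
  that \<open>K[Z] \<subseteq> K[V]\<close> for \<open>Z \<subseteq> V\<close> is literal inclusion.
\<close>

type_synonym 'k mpoly = "(nat \<Rightarrow>\<^sub>0 nat) \<Rightarrow>\<^sub>0 'k"

definition poly_ring :: "nat set \<Rightarrow> ('k::field) mpoly ring" where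
  "poly_ring V =
    \<lparr>carrier = {p. \<forall>e \<in> Poly_Mapping.keys p. Poly_Mapping.keys e \<subseteq> V},
     mult = (*), one = 1, zero = 0, add = (+)\<rparr>"

definition monomial_ideal :: "nat set \<Rightarrow> ('k::field) mpoly set \<Rightarrow> bool" where
  "monomial_ideal V I \<longleftrightarrow>
    (\<exists>E. (\<forall>e \<in> E. Poly_Mapping.keys e \<subseteq> V) \<and>
         I = Idl\<^bsub>poly_ring V\<^esub> ((\<lambda>e. Poly_Mapping.single e 1) ` E))"


section \<open>Multigraded modules\<close>

text \<open>
  The group \<open>\<int>\<^sup>N\<close> of degrees for the variable set \<open>V\<close> with \<open>N = card V\<close>: integer vectors indexed
  by \<open>V\<close>, extended by \<open>0\<close>.
\<close>

definition degrees :: "nat set \<Rightarrow> (nat \<Rightarrow> int) set" where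
  "degrees V = {a. \<forall>v. v \<notin> V \<longrightarrow> a v = 0}"

text \<open>
  A module together with its homogeneous components; \<open>hpart M a\<close> is the component of degree \<open>a\<close>.
\<close>

record ('a, 'b) graded_module = "('a, 'b) module" +
  hpart :: "(nat \<Rightarrow> int) \<Rightarrow> 'b set"

text \<open>An ideal \<open>P\<close> of \<open>K[V]\<close> as a graded \<open>K[V]\<close>-module, with \<open>x\<^sup>e\<close> in degree \<open>e\<close>.\<close>

definition ideal_module ::
    "nat set \<Rightarrow> ('k::field) mpoly set \<Rightarrow> ('k mpoly, 'k mpoly) graded_module" where
  "ideal_module V P =
    \<lparr>carrier = P, mult = undefined, one = undefined, zero = 0, add = (+), smult = (*),
     hpart = (\<lambda>a. {p \<in> P. \<forall>e \<in> Poly_Mapping.keys p. \<forall>v. int (Poly_Mapping.lookup e v) = a v})\<rparr>"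

text \<open>
  The quotient \<open>M/Q\<close> by a graded submodule \<open>Q\<close>; its elements are the cosets of \<open>Q\<close>, and its
  homogeneous components are the images of those of \<open>M\<close>.
\<close>

definition quot_module :: "('a, 'b) graded_module \<Rightarrow> 'b set \<Rightarrow> ('a, 'b set) graded_module" where
  "quot_module M Q =
    \<lparr>carrier = a_rcosets\<^bsub>M\<^esub> Q, mult = undefined, one = undefined, zero = Q, add = set_add M,
     smult = (\<lambda>a X. \<Union>x\<in>X. Q +>\<^bsub>M\<^esub> (a \<odot>\<^bsub>M\<^esub> x)),
     hpart = (\<lambda>a. (\<lambda>x. Q +>\<^bsub>M\<^esub> x) ` hpart M a)\<rparr>"


section \<open>Stanley depth\<close>

definition internal_direct_sum :: "('b, 'c) ring_scheme \<Rightarrow> 'i set \<Rightarrow> ('i \<Rightarrow> 'b set) \<Rightarrow> bool" where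
  "internal_direct_sum M I U \<longleftrightarrow>
    (\<forall>i\<in>I. additive_subgroup (U i) M) \<and>
    (\<forall>x\<in>carrier M. \<exists>F y. finite F \<and> F \<subseteq> I \<and> y \<in> Pi F U \<and> x = (\<Oplus>\<^bsub>M\<^esub>i\<in>F. y i)) \<and>
    (\<forall>F y. finite F \<and> F \<subseteq> I \<and> y \<in> Pi F U \<and> (\<Oplus>\<^bsub>M\<^esub>i\<in>F. y i) = \<zero>\<^bsub>M\<^esub> \<longrightarrow> (\<forall>i\<in>F. y i = \<zero>\<^bsub>M\<^esub>))"

definition stanley_space :: "(('k::field) mpoly, 'b, 'c) module_scheme \<Rightarrow> 'b \<Rightarrow> nat set \<Rightarrow> 'b set" where
  "stanley_space M m Z = {u \<odot>\<^bsub>M\<^esub> m |u. u \<in> carrier (poly_ring Z)}"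

text \<open>
  A decomposition is a list of pairs \<open>(m, Z)\<close>. Freeness of \<open>m K[Z]\<close> means free with basis \<open>m\<close>, so
  \<open>m \<noteq> 0\<close>. As every \<open>m\<close> is homogeneous, every \<open>m K[Z]\<close> is a graded subspace, hence the direct sum is
  one of graded \<open>K\<close>-vector spaces.
\<close>

definition stanley_decomposition ::
    "nat set \<Rightarrow> (('k::field) mpoly, 'b) graded_module \<Rightarrow> ('b \<times> nat set) list \<Rightarrow> bool" where
  "stanley_decomposition V M D \<longleftrightarrow>
    (\<forall>(m, Z) \<in> set D.
       (\<exists>a \<in> degrees V. m \<in> hpart M a) \<and> Z \<subseteq> V \<and>
       (\<forall>u \<in> carrier (poly_ring Z). u \<odot>\<^bsub>M\<^esub> m = \<zero>\<^bsub>M\<^esub> \<longrightarrow> u = 0)) \<and>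
    internal_direct_sum M {..<length D} (\<lambda>i. stanley_space M (fst (D ! i)) (snd (D ! i)))"

definition sdepth_decomp :: "('b \<times> nat set) list \<Rightarrow> nat" where
  "sdepth_decomp D = Min ((\<lambda>(m, Z). card Z) ` set D)"

text \<open>
  Meant for finite \<open>V\<close> and finitely generated graded \<open>M \<noteq> 0\<close>; then the set below is finite and
  nonempty, and its supremum is its maximum. For \<open>M = 0\<close> the only decomposition is \<open>[]\<close>, and the
  value is unspecified.
\<close>

definition sdepth :: "nat set \<Rightarrow> (('k::field) mpoly, 'b) graded_module \<Rightarrow> nat" where
  "sdepth V M = Sup {sdepth_decomp D |D. stanley_decomposition V M D}"

end

theory Submission
  imports Defs "HOL-Library.Set_Algebras" "HOL-Library.Disjoint_Sets"
begin

text \<open>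
  For monomial ideals \<open>Q \<subseteq> P\<close>, a Stanley decomposition of \<open>P/Q\<close> is the same as a partition of the
  exponent vectors in \<open>P\<close> but not in \<open>Q\<close> into finitely many cones \<open>e + \<nat>\<^sup>Z\<close>. Since \<open>I\<close> and \<open>J\<close>
  involve disjoint variables, \<open>I\<^sup>k J\<^sup>i = I\<^sup>k \<inter> J\<^sup>i\<close>; hence the monomials of
  \<open>(I + J)\<^sup>n = \<Sum>\<^sub>i I\<^bsup>n-i\<^esup> J\<^sup>i\<close> are the disjoint union of those of \<open>I\<^sup>n\<close> and those of
  \<open>I\<^bsup>n-i\<^esup> J\<^sup>i\<close> outside \<open>I\<^bsup>n-i+1\<^esup> J\<^sup>i\<close> for \<open>1 \<le> i \<le> n\<close>, and optimal cone partitions of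
  the pieces together form one of the whole. All these pieces are nonempty, which rules out the
  unspecified depth of the zero module.
\<close>

section \<open>Monomial ideals as sets of exponent vectors\<close>

definition exps :: "nat set \<Rightarrow> (nat \<Rightarrow>\<^sub>0 nat) set" where
  "exps V = {e. Poly_Mapping.keys e \<subseteq> V}"

text \<open>This is the \<open>K\<close>-linear span of the monomials with exponents in
  \<open>A\<close>. Polynomial rings, monomial ideals and Stanley spaces of monomials are all of
  this form, so statements about them become statements about sets of exponents.\<close>

definition mspan :: "(nat \<Rightarrow>\<^sub>0 nat) set \<Rightarrow> ('k::field) mpoly set" where
  "mspan A = {p. Poly_Mapping.keys p \<subseteq> A}"

lemma zero_in_exps [simp]: "0 \<in> exps V"
  by (simp add: exps_def)

lemma exps_mono: "Z \<subseteq> V \<Longrightarrow> exps Z \<subseteq> exps V"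
  by (auto simp: exps_def)

lemma exps_iff: "e \<in> exps V \<longleftrightarrow> (\<forall>v. v \<notin> V \<longrightarrow> Poly_Mapping.lookup e v = 0)"
  by (auto simp: exps_def in_keys_iff)

lemma exps_add_iff [simp]: "a + b \<in> exps V \<longleftrightarrow> a \<in> exps V \<and> b \<in> exps V"
  by (auto simp: exps_iff lookup_add)

lemma exps_plus_exps [simp]: "exps V + exps V = exps V"
proof
  show "exps V \<subseteq> exps V + exps V"
    using set_plus_intro[of 0 "exps V"] by fastforce
qed (auto elim!: set_plus_elim)

lemma mspan_zero [simp]: "0 \<in> mspan A"
  by (simp add: mspan_def)

lemma mspan_add: "p \<in> mspan A \<Longrightarrow> q \<in> mspan A \<Longrightarrow> p + q \<in> mspan A"
  using Poly_Mapping.keys_add[of p q] by (auto simp: mspan_def)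

lemma mspan_uminus [simp]: "- p \<in> mspan A \<longleftrightarrow> p \<in> mspan A"
  by (auto simp: mspan_def in_keys_iff)

lemma mspan_diff: "p \<in> mspan A \<Longrightarrow> q \<in> mspan A \<Longrightarrow> p - q \<in> mspan A"
  using mspan_add[of p A "- q"] by simp

lemma mspan_mono: "A \<subseteq> B \<Longrightarrow> mspan A \<subseteq> mspan B"
  by (auto simp: mspan_def)

lemma mspan_mult:
  assumes "p \<in> mspan A" "q \<in> mspan B"
  shows "p * q \<in> mspan (A + B)"
  using keys_mult[of p q] assms by (fastforce simp: mspan_def)

lemma mspan_sum: "(\<And>i. i \<in> F \<Longrightarrow> p i \<in> mspan A) \<Longrightarrow> sum p F \<in> mspan A"
  by (induction F rule: infinite_finite_induct) (auto intro: mspan_add)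

lemma single_in_mspan_iff: "Poly_Mapping.single e c \<in> mspan A \<longleftrightarrow> c = 0 \<or> e \<in> A"
  by (auto simp: mspan_def)

lemma single_eq_zero_iff [simp]: "Poly_Mapping.single e c = 0 \<longleftrightarrow> c = 0"
  by (metis lookup_single_eq lookup_zero single_zero)

lemma mspan_nonzero:
  assumes "A \<noteq> {}"
  shows "(mspan A :: ('k::field) mpoly set) \<noteq> {0}"
proof -
  obtain e where "e \<in> A"
    using assms by blast
  then have "Poly_Mapping.single e (1::'k) \<in> mspan A"
    by (simp add: single_in_mspan_iff)
  moreover have "Poly_Mapping.single e (1::'k) \<noteq> 0"
    by simp
  ultimately show ?thesis
    by blast
qed

lemma mpoly_eq_sum_single:
  "p = (\<Sum>e\<in>Poly_Mapping.keys p. Poly_Mapping.single e (Poly_Mapping.lookup p e))"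
  by (rule poly_mapping_eqI)
    (auto simp: lookup_sum lookup_single when_def in_keys_iff)

section \<open>Polynomial rings and their ideals generated by monomials\<close>

lemma carrier_poly_ring: "carrier (poly_ring V) = mspan (exps V)"
  by (auto simp: poly_ring_def mspan_def exps_def)

lemma poly_ring_simps [simp]:
  "mult (poly_ring V) = (*)" "one (poly_ring V) = 1"
  "zero (poly_ring V) = 0" "add (poly_ring V) = (+)"
  by (simp_all add: poly_ring_def)

lemma cring_poly_ring: "cring (poly_ring V :: ('k::field) mpoly ring)"
proof (rule cringI)
  show "abelian_group (poly_ring V :: 'k mpoly ring)"
  proof (rule abelian_groupI)
    fix x :: "'k mpoly" assume "x \<in> carrier (poly_ring V)"
    then show "\<exists>y\<in>carrier (poly_ring V). y \<oplus>\<^bsub>poly_ring V\<^esub> x = \<zero>\<^bsub>poly_ring V\<^esub>"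
      by (intro bexI[of _ "- x"]) (simp_all add: carrier_poly_ring)
  qed (auto simp: carrier_poly_ring algebra_simps intro: mspan_add)
  show "comm_monoid (poly_ring V :: 'k mpoly ring)"
  proof (rule comm_monoidI)
    fix x y :: "'k mpoly" assume "x \<in> carrier (poly_ring V)" "y \<in> carrier (poly_ring V)"
    then show "x \<otimes>\<^bsub>poly_ring V\<^esub> y \<in> carrier (poly_ring V)"
      using mspan_mult[of x "exps V" y "exps V"] by (simp add: carrier_poly_ring)
  next
    show "\<one>\<^bsub>poly_ring V\<^esub> \<in> carrier (poly_ring V :: 'k mpoly ring)"
      by (simp add: carrier_poly_ring mspan_def)
  qed (auto simp: algebra_simps)
qed (auto simp: algebra_simps)

lemma ideal_mspan:
  assumes "A \<subseteq> exps V" "exps V + A \<subseteq> A"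
  shows "ideal (mspan A :: ('k::field) mpoly set) (poly_ring V)"
proof (rule idealI)
  interpret R: cring "poly_ring V :: 'k mpoly ring"
    by (rule cring_poly_ring)
  show "ring (poly_ring V :: 'k mpoly ring)"
    by (rule R.ring_axioms)
  have minus: "\<ominus>\<^bsub>poly_ring V\<^esub> p = - p" if "p \<in> carrier (poly_ring V)" for p :: "'k mpoly"
    using that R.minus_equality[of "- p" p] by (simp add: carrier_poly_ring)
  show "subgroup (mspan A :: 'k mpoly set) (add_monoid (poly_ring V))"
  proof (rule R.add.subgroupI)
    show "mspan A \<subseteq> (carrier (poly_ring V) :: 'k mpoly set)"
      using assms(1) by (simp add: carrier_poly_ring mspan_mono)
    then show "\<ominus>\<^bsub>poly_ring V\<^esub> p \<in> mspan A" if "p \<in> mspan A" for p :: "'k mpoly"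
      using that minus by (auto simp: subset_iff)
    show "(mspan A :: 'k mpoly set) \<noteq> {}"
      using mspan_zero by blast
  qed (auto intro: mspan_add)
  fix a x :: "'k mpoly" assume "a \<in> mspan A" "x \<in> carrier (poly_ring V)"
  then have "x * a \<in> mspan A"
    using mspan_mult[of x "exps V" a A] mspan_mono[OF assms(2)] by (auto simp: carrier_poly_ring)
  then show "x \<otimes>\<^bsub>poly_ring V\<^esub> a \<in> mspan A" "a \<otimes>\<^bsub>poly_ring V\<^esub> x \<in> mspan A"
    by (simp_all add: mult.commute)
qed

text \<open>Letting \<open>S\<close> be any set between the generating monomials and their ideal
  serves two uses at once: the ideal generated by the monomials themselves, and the extension of
  such an ideal to a ring with more variables.\<close>

lemma genideal_mspan:
  assumes "E \<subseteq> exps V" "(\<lambda>e. Poly_Mapping.single e 1) ` E \<subseteq> S" "S \<subseteq> mspan (exps V + E)"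
  shows "Idl\<^bsub>poly_ring V\<^esub> S = (mspan (exps V + E) :: ('k::field) mpoly set)"
proof
  interpret R: cring "poly_ring V :: 'k mpoly ring"
    by (rule cring_poly_ring)
  have sub: "exps V + E \<subseteq> exps V"
    using assms(1) by (auto elim!: set_plus_elim)
  have "ideal (mspan (exps V + E) :: 'k mpoly set) (poly_ring V)"
    by (rule ideal_mspan[OF sub]) (simp add: add.assoc[symmetric])
  then show "Idl\<^bsub>poly_ring V\<^esub> S \<subseteq> mspan (exps V + E)"
    using assms(3) by (rule R.genideal_minimal)
  have S: "S \<subseteq> carrier (poly_ring V)"
    using assms(3) mspan_mono[OF sub] by (auto simp: carrier_poly_ring)
  interpret I: ideal "Idl\<^bsub>poly_ring V\<^esub> S" "poly_ring V"
    by (rule R.genideal_ideal[OF S])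
  show "mspan (exps V + E) \<subseteq> Idl\<^bsub>poly_ring V\<^esub> S"
  proof
    fix p :: "'k mpoly" assume p: "p \<in> mspan (exps V + E)"
    have mono: "Poly_Mapping.single e c \<in> Idl\<^bsub>poly_ring V\<^esub> S" if e: "e \<in> exps V + E" for e c
    proof -
      obtain a b where ab: "e = a + b" "a \<in> exps V" "b \<in> E"
        using set_plus_elim[OF e] by blast
      have "Poly_Mapping.single b 1 \<in> Idl\<^bsub>poly_ring V\<^esub> S"
        using ab(3) assms(2) R.genideal_self[OF S] by blast
      then have "Poly_Mapping.single a c * Poly_Mapping.single b 1 \<in> Idl\<^bsub>poly_ring V\<^esub> S"
        using I.I_l_closed[of "Poly_Mapping.single b 1" "Poly_Mapping.single a c"] ab(2)
        by (simp add: carrier_poly_ring single_in_mspan_iff)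
      then show ?thesis
        by (simp add: mult_single ab(1))
    qed
    \<comment> \<open>The polynomial \<open>p\<close> is rebuilt term by term; the induction runs
      over partial sums because these still have their exponents in
      \<open>exps V + E\<close>.\<close>
    have "(\<Sum>e\<in>F. Poly_Mapping.single e (Poly_Mapping.lookup p e)) \<in> Idl\<^bsub>poly_ring V\<^esub> S"
      if "F \<subseteq> Poly_Mapping.keys p" for F
      using finite_subset[OF that finite_keys] that
    proof (induction F rule: finite_induct)
      case empty
      then show ?case
        using I.zero_closed by simp
    next
      case (insert e F)
      then have "e \<in> exps V + E"
        using p by (auto simp: mspan_def)
      from I.a_closed[OF mono[OF this]] insert show ?case
        by simp
    qed
    from this[OF order.refl] show "p \<in> Idl\<^bsub>poly_ring V\<^esub> S"
      by (simp flip: mpoly_eq_sum_single)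
  qed
qed

section \<open>Sums, products and powers of spans of monomials\<close>

lemma sum_mspan_split:
  assumes "p \<in> mspan (A \<union> B)"
  obtains q r where "p = q + r" "q \<in> mspan A" "r \<in> mspan B"
proof
  let ?s = "\<lambda>e. Poly_Mapping.single e (Poly_Mapping.lookup p e)"
  show "sum ?s (Poly_Mapping.keys p \<inter> A) \<in> mspan A" "sum ?s (Poly_Mapping.keys p - A) \<in> mspan B"
    using assms by (intro mspan_sum; force simp: single_in_mspan_iff mspan_def)+
  have "p = sum ?s (Poly_Mapping.keys p)"
    by (rule mpoly_eq_sum_single)
  also have "\<dots> = sum ?s (Poly_Mapping.keys p \<inter> A) + sum ?s (Poly_Mapping.keys p - A)"
    by (rule sum.Int_Diff) simp
  finally show "p = \<dots>" .
qed

lemma set_add_mspan: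
  "mspan A <+>\<^bsub>poly_ring V\<^esub> mspan B = (mspan (A \<union> B) :: ('k::field) mpoly set)"
proof -
  have "p + q \<in> mspan (A \<union> B)" if "p \<in> mspan A" "q \<in> mspan B" for p q :: "'k mpoly"
    using that mspan_mono[of A "A \<union> B"] mspan_mono[of B "A \<union> B"] by (intro mspan_add) auto
  then show ?thesis
    by (auto simp: set_add_def' elim!: sum_mspan_split)
qed

lemma ideal_prod_mspan:
  "mspan A \<cdot>\<^bsub>poly_ring V\<^esub> mspan B = (mspan (A + B) :: ('k::field) mpoly set)"
proof
  show "mspan A \<cdot>\<^bsub>poly_ring V\<^esub> mspan B \<subseteq> (mspan (A + B) :: 'k mpoly set)"
  proof
    fix p :: "'k mpoly" assume "p \<in> mspan A \<cdot>\<^bsub>poly_ring V\<^esub> mspan B"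
    then show "p \<in> mspan (A + B)"
      by induction (auto intro: mspan_mult mspan_add)
  qed
  show "mspan (A + B) \<subseteq> (mspan A \<cdot>\<^bsub>poly_ring V\<^esub> mspan B :: 'k mpoly set)"
  proof
    fix p :: "'k mpoly" assume p: "p \<in> mspan (A + B)"
    have "(\<Sum>e\<in>F. Poly_Mapping.single e (Poly_Mapping.lookup p e))
        \<in> mspan A \<cdot>\<^bsub>poly_ring V\<^esub> mspan B" if "F \<subseteq> Poly_Mapping.keys p" for F
      using finite_subset[OF that finite_keys] that
    proof (induction F rule: finite_induct)
      case empty
      then show ?case
        using ideal_prod.prod[of 0 "mspan A" 0 "mspan B" "poly_ring V :: 'k mpoly ring"] by simp
    next
      case (insert e F)
      then have "e \<in> A + B"
        using p by (auto simp: mspan_def)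
      then obtain a b where ab: "e = a + b" "a \<in> A" "b \<in> B"
        by (rule set_plus_elim)
      \<comment> \<open>The coefficient is put into the first factor, so each term of
        \<open>p\<close> is one product of an element of \<open>mspan A\<close> and one of
        \<open>mspan B\<close>.\<close>
      then have "Poly_Mapping.single e (Poly_Mapping.lookup p e)
          \<in> mspan A \<cdot>\<^bsub>poly_ring V\<^esub> mspan B"
        using ideal_prod.prod[of "Poly_Mapping.single a (Poly_Mapping.lookup p e)" "mspan A"
            "Poly_Mapping.single b 1" "mspan B" "poly_ring V"]
        by (simp add: single_in_mspan_iff mult_single)
      from ideal_prod.sum[OF this] insert show ?case
        by simp
    qed
    from this[OF order.refl] show "p \<in> mspan A \<cdot>\<^bsub>poly_ring V\<^esub> mspan B"
      by (simp flip: mpoly_eq_sum_single)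
  qed
qed

text \<open>Here \<open>\<Sum>i<k. E\<close> is the \<open>k\<close>-fold sumset of
  \<open>E\<close>, that is, the exponents of products of \<open>k\<close> generators. It is
  \<open>{0}\<close> for \<open>k = 0\<close>, which matches the zeroth power being the whole ring;
  repeated summands \<open>exps V\<close> collapse into one.\<close>

lemma ideal_pow_mspan:
  "mspan (exps V + E) [^]\<^bsub>ideals_set (poly_ring V)\<^esub> (k::nat) =
    (mspan (exps V + (\<Sum>i<k. E)) :: ('k::field) mpoly set)"
proof (induction k)
  case 0
  then show ?case
    by (simp add: ideals_set_def carrier_poly_ring)
next
  case (Suc k)
  have "(exps V + sum (\<lambda>_. E) {..<k}) + (exps V + E) = exps V + exps V + (sum (\<lambda>_. E) {..<k} + E)"
    by (simp only: ac_simps)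
  then show ?case
    using Suc by (simp add: ideals_set_def ideal_prod_mspan)
qed


section \<open>Cone partitions and Stanley decompositions\<close>

text \<open>These are the exponents of the monomials in the Stanley space
  \<open>x^e K[Z]\<close>.\<close>

definition cone :: "(nat \<Rightarrow>\<^sub>0 nat) \<Rightarrow> nat set \<Rightarrow> (nat \<Rightarrow>\<^sub>0 nat) set" where
  "cone e Z = (+) e ` exps Z"

text \<open>The cones are indexed by the pairs themselves. Since a cone is never empty, disjointness
  over \<open>S\<close> also says that no cone arises from two different pairs. The number
  \<open>card Z\<close> remains visible in each pair, which is all that the Stanley depth
  needs.\<close>

definition cone_partition ::
    "nat set \<Rightarrow> ((nat \<Rightarrow>\<^sub>0 nat) \<times> nat set) set \<Rightarrow> (nat \<Rightarrow>\<^sub>0 nat) set \<Rightarrow> bool" where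
  "cone_partition V S A \<longleftrightarrow>
    finite S \<and> (\<forall>(e, Z) \<in> S. Z \<subseteq> V) \<and>
    disjoint_family_on (\<lambda>(e, Z). cone e Z) S \<and> (\<Union>(e, Z)\<in>S. cone e Z) = A"

lemma apex_in_cone [simp]: "e \<in> cone e Z"
  unfolding cone_def using zero_in_exps by (force intro: image_eqI[of _ _ 0])

lemma cone_partition_UN:
  assumes "finite T" "disjoint_family_on A T" "\<And>i. i \<in> T \<Longrightarrow> cone_partition V (S i) (A i)"
  shows "cone_partition V (\<Union>i\<in>T. S i) (\<Union>i\<in>T. A i)"
proof -
  have cover: "(\<Union>(e, Z)\<in>S i. cone e Z) = A i" if "i \<in> T" for i
    using assms(3)[OF that] by (simp add: cone_partition_def)
  have "cone (fst p) (snd p) \<inter> cone (fst q) (snd q) = {}"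
    if "i \<in> T" "j \<in> T" "p \<in> S i" "q \<in> S j" "p \<noteq> q" for i j p q
  proof (cases "i = j")
    case True
    then show ?thesis
      using that assms(3)[of i] by (simp add: cone_partition_def disjoint_family_on_def split_beta)
  next
    case False
    then have "A i \<inter> A j = {}"
      using assms(2) that(1,2) by (simp add: disjoint_family_on_def)
    then show ?thesis
      using cover[OF that(1)] cover[OF that(2)] that(3,4) by (auto simp: split_beta)
  qed
  then have "disjoint_family_on (\<lambda>(e, Z). cone e Z) (\<Union>i\<in>T. S i)"
    unfolding disjoint_family_on_def split_beta by blast
  moreover have "(\<Union>(e, Z)\<in>(\<Union>i\<in>T. S i). cone e Z) = (\<Union>i\<in>T. A i)"
    using cover by auto
  moreover have "finite (\<Union>i\<in>T. S i)"
    using assms(1,3) by (auto simp: cone_partition_def)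
  moreover have "\<forall>(e, Z)\<in>(\<Union>i\<in>T. S i). Z \<subseteq> V"
    using assms(3) unfolding cone_partition_def by blast
  ultimately show ?thesis
    by (simp add: cone_partition_def)
qed

section \<open>From Stanley decompositions to cone partitions\<close>

lemma ideal_module_simps [simp]:
  "carrier (ideal_module V P) = P" "zero (ideal_module V P) = 0"
  "add (ideal_module V P) = (+)" "smult (ideal_module V P) = (*)"
  by (simp_all add: ideal_module_def)

lemma abelian_group_ideal_module:
  "abelian_group (ideal_module V (mspan A) :: ('k::field mpoly, 'k mpoly) graded_module)"
proof (rule abelian_groupI)
  fix x :: "'k mpoly" assume "x \<in> carrier (ideal_module V (mspan A))"
  then show "\<exists>y\<in>carrier (ideal_module V (mspan A)).
      y \<oplus>\<^bsub>ideal_module V (mspan A)\<^esub> x = \<zero>\<^bsub>ideal_module V (mspan A)\<^esub>"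
    by (intro bexI[of _ "- x"]) simp_all
qed (auto simp: algebra_simps intro: mspan_add)

text \<open>This moves sums in the abstract module \<open>M\<close> back to ordinary sums of
  polynomials, where coefficients can be compared. Additivity of \<open>f\<close> is asked only on
  \<open>mspan A\<close>, the domain on which the projection to a quotient is considered.\<close>

lemma finsum_hom:
  assumes "abelian_monoid M"
    and "\<And>p. p \<in> mspan A \<Longrightarrow> f p \<in> carrier M"
    and "\<And>p q. p \<in> mspan A \<Longrightarrow> q \<in> mspan A \<Longrightarrow> f (p + q) = f p \<oplus>\<^bsub>M\<^esub> f q"
    and "f 0 = \<zero>\<^bsub>M\<^esub>" and "finite F" and "\<And>i. i \<in> F \<Longrightarrow> p i \<in> mspan A"
  shows "(\<Oplus>\<^bsub>M\<^esub>i\<in>F. f (p i)) = f (sum p F)"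
proof -
  interpret M: abelian_monoid M by fact
  show ?thesis
    using assms(5,6)
  proof (induction F rule: finite_induct)
    case empty
    then show ?case
      using assms(4) by simp
  next
    case (insert i F)
    then have "sum p F \<in> mspan A"
      by (auto intro: mspan_sum)
    with insert show ?case
      using assms(2,3) by (simp add: Pi_def)
  qed
qed

lemma finsum_ideal_module:
  assumes "finite F" "\<And>i. i \<in> F \<Longrightarrow> p i \<in> mspan A"
  shows "(\<Oplus>\<^bsub>ideal_module V (mspan A)\<^esub>i\<in>F. p i) = sum p F"
  by (rule finsum_hom[where f = "\<lambda>p. p", OF abelian_group.axioms(1)[OF abelian_group_ideal_module]])
    (use assms in auto)

text \<open>A multidegree determines the exponent vector, so a homogeneous component contains the
  multiples of at most one monomial.\<close>

lemma hpart_ideal_module_mspan: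
  assumes "p \<in> hpart (ideal_module V (mspan A)) a" "p \<noteq> 0"
  obtains e c where "p = Poly_Mapping.single e c" "c \<noteq> 0" "e \<in> A"
proof -
  have p: "p \<in> mspan A" "\<And>e v. e \<in> Poly_Mapping.keys p \<Longrightarrow> int (Poly_Mapping.lookup e v) = a v"
    using assms(1) by (auto simp: ideal_module_def)
  obtain e where e: "e \<in> Poly_Mapping.keys p"
    using assms(2) by fastforce
  have "e' = e" if "e' \<in> Poly_Mapping.keys p" for e'
    using p(2)[OF e] p(2)[OF that] by (intro poly_mapping_eqI) (metis of_nat_eq_iff)
  then have "Poly_Mapping.keys p = {e}"
    using e by blast
  then have "p = Poly_Mapping.single e (Poly_Mapping.lookup p e)"
    using mpoly_eq_sum_single[of p] by simp
  moreover have "Poly_Mapping.lookup p e \<noteq> 0"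
    using e by (simp add: in_keys_iff)
  ultimately show thesis
    using that e p(1) by (auto simp: mspan_def)
qed

lemma keys_mult_single_subset_cone:
  assumes "u \<in> mspan (exps Z)"
  shows "Poly_Mapping.keys (u * Poly_Mapping.single e c) \<subseteq> cone e Z"
  using keys_mult[of u "Poly_Mapping.single e c"] assms
  by (fastforce simp: mspan_def cone_def add.commute split: if_splits)

lemma internal_direct_sum_coverE:
  assumes "internal_direct_sum M T U" "x \<in> carrier M"
  obtains F y where "finite F" "F \<subseteq> T" "y \<in> Pi F U" "x = (\<Oplus>\<^bsub>M\<^esub>i\<in>F. y i)"
  using assms unfolding internal_direct_sum_def by blast

lemma internal_direct_sum_zeroD:
  assumes "internal_direct_sum M T U" "finite F" "F \<subseteq> T" "y \<in> Pi F U"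
    and "(\<Oplus>\<^bsub>M\<^esub>i\<in>F. y i) = \<zero>\<^bsub>M\<^esub>" "i \<in> F"
  shows "y i = \<zero>\<^bsub>M\<^esub>"
  using assms unfolding internal_direct_sum_def by blast

text \<open>\<open>f\<close> is the identity for an ideal and the projection for a quotient of ideals.\<close>

lemma cone_partition_of_stanley_decomposition:
  fixes M :: "(('k::field) mpoly, 'b) graded_module" and f :: "'k mpoly \<Rightarrow> 'b"
  assumes M: "abelian_monoid M"
    and carrier: "\<And>p. p \<in> mspan A \<Longrightarrow> f p \<in> carrier M"
    and add: "\<And>p q. p \<in> mspan A \<Longrightarrow> q \<in> mspan A \<Longrightarrow> f (p + q) = f p \<oplus>\<^bsub>M\<^esub> f q"
    and smult: "\<And>u p. u \<in> mspan (exps V) \<Longrightarrow> p \<in> mspan A \<Longrightarrow> u \<odot>\<^bsub>M\<^esub> f p = f (u * p)"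
    and kernel: "\<And>p. p \<in> mspan A \<Longrightarrow> f p = \<zero>\<^bsub>M\<^esub> \<longleftrightarrow> p \<in> mspan B"
    and hpart: "\<And>a. hpart M a = f ` hpart (ideal_module V (mspan A)) a"
    and A: "exps V + A \<subseteq> A"
    and D: "stanley_decomposition V M D"
  shows "\<exists>S. cone_partition V S (A - B) \<and> (\<forall>p\<in>S. sdepth_decomp D \<le> card (snd p))"
proof -
  interpret M: abelian_monoid M by fact
  have f0: "f 0 = \<zero>\<^bsub>M\<^esub>"
    using kernel[of 0] by simp
  have A': "u * p \<in> mspan A" if "u \<in> mspan (exps V)" "p \<in> mspan A" for u p :: "'k mpoly"
    using mspan_mult[OF that] mspan_mono[OF A] by blast
  let ?Z = "\<lambda>i. snd (D ! i)"
  have Z: "?Z i \<subseteq> V" if "i < length D" for i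
    using D nth_mem[OF that] by (fastforce simp: stanley_decomposition_def)
  have free: "u = 0" if "i < length D" "u \<in> mspan (exps (?Z i))" "u \<odot>\<^bsub>M\<^esub> fst (D ! i) = \<zero>\<^bsub>M\<^esub>" for i u
    using D nth_mem[OF that(1)] that(2,3)
    by (fastforce simp: stanley_decomposition_def carrier_poly_ring)
  have sum: "internal_direct_sum M {..<length D} (\<lambda>i. stanley_space M (fst (D ! i)) (?Z i))"
    using D by (simp add: stanley_decomposition_def)
  \<comment> \<open>Each generator is the image of a homogeneous polynomial. Freeness, applied to
    \<open>u = 1\<close>, shows that this image is nonzero, so the polynomial is a single
    term.\<close>
  have "\<exists>e c. fst (D ! i) = f (Poly_Mapping.single e c) \<and> c \<noteq> 0 \<and> e \<in> A" if i: "i < length D" for i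
  proof -
    obtain a where "fst (D ! i) \<in> hpart M a"
      using D nth_mem[OF i] by (fastforce simp: stanley_decomposition_def)
    then obtain p where p: "fst (D ! i) = f p" "p \<in> hpart (ideal_module V (mspan A)) a"
      using hpart by blast
    have pA: "p \<in> mspan A"
      using p(2) by (simp add: ideal_module_def)
    have "1 \<odot>\<^bsub>M\<^esub> f p \<noteq> \<zero>\<^bsub>M\<^esub>"
      using free[OF i, of 1] p(1) by (auto simp: mspan_def)
    then have "f p \<noteq> \<zero>\<^bsub>M\<^esub>"
      using smult[OF _ pA, of 1] by (simp add: mspan_def)
    then have "p \<noteq> 0"
      using f0 by auto
    with p(2) show ?thesis
      using p(1) by (metis hpart_ideal_module_mspan)
  qed
  then obtain e c where ec: "\<And>i. i < length D \<Longrightarrow> fst (D ! i) = f (Poly_Mapping.single (e i) (c i))"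
    "\<And>i. i < length D \<Longrightarrow> c i \<noteq> 0" "\<And>i. i < length D \<Longrightarrow> e i \<in> A"
    by metis
  have generator: "Poly_Mapping.single (e i) (c i) \<in> mspan A" if "i < length D" for i
    using ec(3)[OF that] by (simp add: single_in_mspan_iff)
  have lift: "u \<odot>\<^bsub>M\<^esub> fst (D ! i) = f (u * Poly_Mapping.single (e i) (c i))"
    "u * Poly_Mapping.single (e i) (c i) \<in> mspan A"
    if "i < length D" "u \<in> mspan (exps (?Z i))" for i u
  proof -
    have "u \<in> mspan (exps V)"
      using that mspan_mono[OF exps_mono[OF Z]] by blast
    then show "u \<odot>\<^bsub>M\<^esub> fst (D ! i) = f (u * Poly_Mapping.single (e i) (c i))"
      "u * Poly_Mapping.single (e i) (c i) \<in> mspan A"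
      using smult A' generator ec(1) that(1) by auto
  qed
  \<comment> \<open>A monomial multiple of the generator is again the image of a single term.
    Freeness keeps it nonzero, so its exponent lies outside \<open>B\<close>.\<close>
  have cone_sub: "cone (e i) (?Z i) \<subseteq> A - B" if i: "i < length D" for i
  proof
    fix t assume "t \<in> cone (e i) (?Z i)"
    then obtain z where z: "z \<in> exps (?Z i)" "t = e i + z"
      by (auto simp: cone_def)
    let ?u = "Poly_Mapping.single z (1::'k)"
    have u: "?u \<in> mspan (exps (?Z i))"
      using z(1) by (simp add: single_in_mspan_iff)
    have t: "?u * Poly_Mapping.single (e i) (c i) = Poly_Mapping.single t (c i)"
      by (simp add: mult_single z(2) add.commute)
    have "t \<in> A"
      using lift(2)[OF i u] ec(2)[OF i] by (simp add: t single_in_mspan_iff)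
    moreover have "f (Poly_Mapping.single t (c i)) \<noteq> \<zero>\<^bsub>M\<^esub>"
      using free[OF i u] lift(1)[OF i u] by (auto simp: t)
    ultimately show "t \<in> A - B"
      using kernel[of "Poly_Mapping.single t (c i)"] by (simp add: single_in_mspan_iff)
  qed
  have in_space: "f (Poly_Mapping.single t a) \<in> stanley_space M (fst (D ! i)) (?Z i)"
    if i: "i < length D" and t: "t \<in> cone (e i) (?Z i)" for i t a
  proof -
    obtain z where z: "z \<in> exps (?Z i)" "t = e i + z"
      using t by (auto simp: cone_def)
    \<comment> \<open>The division cancels the coefficient of the generator, so that the product is
      exactly the term with exponent \<open>t\<close> and coefficient \<open>a\<close>.\<close>
    let ?u = "Poly_Mapping.single z (a / c i)"
    have u: "?u \<in> mspan (exps (?Z i))"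
      using z(1) by (simp add: single_in_mspan_iff)
    have "?u * Poly_Mapping.single (e i) (c i) = Poly_Mapping.single t a"
      using ec(2)[OF i] by (simp add: mult_single z(2) add.commute)
    then show ?thesis
      using lift(1)[OF i u] u by (force simp: stanley_space_def carrier_poly_ring)
  qed
  have disjoint: "cone (e i) (?Z i) \<inter> cone (e j) (?Z j) = {}"
    if ij: "i < length D" "j < length D" "i \<noteq> j" for i j
  proof (rule ccontr)
    assume "cone (e i) (?Z i) \<inter> cone (e j) (?Z j) \<noteq> {}"
    then obtain t where t: "t \<in> cone (e i) (?Z i)" "t \<in> cone (e j) (?Z j)"
      by blast
    \<comment> \<open>The monomial with exponent \<open>t\<close> in one summand and its negative in
      the other add up to zero, so directness forces both images to vanish, although
      \<open>t \<notin> B\<close>.\<close>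
    let ?p = "\<lambda>l. Poly_Mapping.single t (if l = i then 1 else - 1 :: 'k)"
    have tAB: "t \<in> A" "t \<notin> B"
      using cone_sub[OF ij(1)] t(1) by auto
    have "(\<Oplus>\<^bsub>M\<^esub>l\<in>{i, j}. f (?p l)) = f (sum ?p {i, j})"
      using tAB by (intro finsum_hom[OF M carrier add f0]) (auto simp: single_in_mspan_iff)
    also have "\<dots> = \<zero>\<^bsub>M\<^esub>"
      using ij(3) f0 by (simp flip: single_add)
    finally have "(\<Oplus>\<^bsub>M\<^esub>l\<in>{i, j}. f (?p l)) = \<zero>\<^bsub>M\<^esub>" .
    moreover have "(\<lambda>l. f (?p l)) \<in> Pi {i, j} (\<lambda>i. stanley_space M (fst (D ! i)) (?Z i))"
      using in_space ij(1,2) t by (auto simp: Pi_def)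
    ultimately have "f (?p i) = \<zero>\<^bsub>M\<^esub>"
      using internal_direct_sum_zeroD[OF sum, of "{i, j}" "\<lambda>l. f (?p l)" i] ij(1,2) by auto
    then show False
      using kernel[of "?p i"] tAB by (simp add: single_in_mspan_iff)
  qed
  have cover: "\<exists>i<length D. t \<in> cone (e i) (?Z i)" if t: "t \<in> A - B" for t
  proof -
    let ?t = "Poly_Mapping.single t (1::'k)"
    have tA: "?t \<in> mspan A"
      using t by (simp add: single_in_mspan_iff)
    obtain F y where F: "finite F" "F \<subseteq> {..<length D}"
      "y \<in> Pi F (\<lambda>i. stanley_space M (fst (D ! i)) (?Z i))" "f ?t = (\<Oplus>\<^bsub>M\<^esub>i\<in>F. y i)"
      by (rule internal_direct_sum_coverE[OF sum carrier[OF tA]])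
    have "\<forall>i\<in>F. \<exists>u \<in> mspan (exps (?Z i)). y i = u \<odot>\<^bsub>M\<^esub> fst (D ! i)"
      using F(3) by (force simp: stanley_space_def carrier_poly_ring)
    then obtain u where u: "\<And>i. i \<in> F \<Longrightarrow> u i \<in> mspan (exps (?Z i))"
      "\<And>i. i \<in> F \<Longrightarrow> y i = u i \<odot>\<^bsub>M\<^esub> fst (D ! i)"
      by metis
    let ?p = "\<lambda>i. u i * Poly_Mapping.single (e i) (c i)"
    have p: "?p i \<in> mspan A" "y i = f (?p i)" if "i \<in> F" for i
      using F(2) that u lift[of i "u i"] by auto
    have pA: "sum ?p F \<in> mspan A"
      using p(1) by (rule mspan_sum)
    have "f ?t = (\<Oplus>\<^bsub>M\<^esub>i\<in>F. f (?p i))"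
      unfolding F(4) using p carrier by (intro M.finsum_cong) (auto simp: simp_implies_def)
    also have "\<dots> = f (sum ?p F)"
      using p(1) F(1) by (intro finsum_hom[OF M carrier add f0]) auto
    finally have eq: "f ?t = f (sum ?p F)" .
    \<comment> \<open>As \<open>M\<close> is only assumed to be an abelian monoid, cancellation is
      replaced by adding \<open>f (- sum ?p F)\<close> to both sides of \<open>eq\<close>.\<close>
    have "f (?t - sum ?p F) = f (?t + (- sum ?p F))"
      by simp
    also have "\<dots> = f (sum ?p F) \<oplus>\<^bsub>M\<^esub> f (- sum ?p F)"
      using add[OF tA, of "- sum ?p F"] pA by (simp add: eq)
    also have "\<dots> = f (sum ?p F + (- sum ?p F))"
      using add[OF pA, of "- sum ?p F"] pA by simp
    finally have "f (?t - sum ?p F) = \<zero>\<^bsub>M\<^esub>"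
      by (simp add: f0)
    then have "?t - sum ?p F \<in> mspan B"
      using kernel[OF mspan_diff[OF tA pA]] by simp
    \<comment> \<open>Since \<open>t \<notin> B\<close>, the term at \<open>t\<close> must cancel in
      the difference. It therefore occurs in some lifted summand, whose exponents all lie in one
      cone.\<close>
    then have "t \<notin> Poly_Mapping.keys (?t - sum ?p F)"
      using t by (auto simp: mspan_def)
    then have "t \<in> Poly_Mapping.keys (sum ?p F)"
      by (auto simp: in_keys_iff lookup_minus)
    then obtain i where "i \<in> F" "t \<in> Poly_Mapping.keys (?p i)"
      using Poly_Mapping.keys_sum[of ?p F] by blast
    then show ?thesis
      using keys_mult_single_subset_cone[OF u(1)] F(2) by blast
  qed
  let ?S = "(\<lambda>i. (e i, ?Z i)) ` {..<length D}"
  have "cone_partition V ?S (A - B)"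
    unfolding cone_partition_def
  proof (intro conjI)
    show "disjoint_family_on (\<lambda>(e, Z). cone e Z) ?S"
      unfolding disjoint_family_on_def
    proof (intro ballI impI)
      fix p q assume "p \<in> ?S" "q \<in> ?S" "p \<noteq> q"
      then obtain i j where "i < length D" "j < length D" "i \<noteq> j"
        "p = (e i, ?Z i)" "q = (e j, ?Z j)"
        by auto
      then show "(case p of (e, Z) \<Rightarrow> cone e Z) \<inter> (case q of (e, Z) \<Rightarrow> cone e Z) = {}"
        using disjoint by simp
    qed
    show "(\<Union>(e, Z)\<in>?S. cone e Z) = A - B"
    proof (intro equalityI subsetI)
      fix t assume "t \<in> A - B"
      with cover obtain i where "i < length D" "t \<in> cone (e i) (?Z i)"
        by blast
      then show "t \<in> (\<Union>(e, Z)\<in>?S. cone e Z)"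
        by auto
    next
      fix t assume "t \<in> (\<Union>(e, Z)\<in>?S. cone e Z)"
      then obtain i where "i < length D" "t \<in> cone (e i) (?Z i)"
        by auto
      then show "t \<in> A - B"
        by (rule subsetD[OF cone_sub])
    qed
  qed (use Z in auto)
  moreover have "sdepth_decomp D \<le> card (?Z i)" if "i < length D" for i
    unfolding sdepth_decomp_def using nth_mem[OF that]
    by (intro Min_le) (auto simp: image_iff case_prod_beta intro: rev_bexI)
  ultimately show ?thesis
    by (intro exI[of _ ?S]) auto
qed

section \<open>From cone partitions to Stanley decompositions\<close>

lemma stanley_space_monomial:
  "stanley_space (ideal_module V P) (Poly_Mapping.single e 1) Z =
    (mspan (cone e Z) :: ('k::field) mpoly set)"
proof
  show "stanley_space (ideal_module V P) (Poly_Mapping.single e 1) Z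
      \<subseteq> (mspan (cone e Z) :: 'k mpoly set)"
    using keys_mult_single_subset_cone[of _ Z e 1]
    by (auto simp: stanley_space_def carrier_poly_ring mspan_def[of "cone e Z"])
  show "mspan (cone e Z)
      \<subseteq> (stanley_space (ideal_module V P) (Poly_Mapping.single e 1) Z :: 'k mpoly set)"
  proof
    fix p :: "'k mpoly" assume "p \<in> mspan (cone e Z)"
    \<comment> \<open>Subtraction of exponent vectors is truncated, but it is exact on the cone,
      where every vector lies above \<open>e\<close>.\<close>
    then have keys: "t - e \<in> exps Z" "t = e + (t - e)" if "t \<in> Poly_Mapping.keys p" for t
      using that by (auto simp: mspan_def cone_def)
    define u where "u = (\<Sum>t\<in>Poly_Mapping.keys p. Poly_Mapping.single (t - e) (Poly_Mapping.lookup p t))"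
    have "u \<in> mspan (exps Z)"
      unfolding u_def using keys(1) by (auto intro!: mspan_sum simp: single_in_mspan_iff)
    moreover have "u * Poly_Mapping.single e 1 =
        (\<Sum>t\<in>Poly_Mapping.keys p. Poly_Mapping.single t (Poly_Mapping.lookup p t))"
      unfolding u_def sum_distrib_right using keys(2)
      by (intro sum.cong refl) (simp add: mult_single add.commute)
    ultimately show "p \<in> stanley_space (ideal_module V P) (Poly_Mapping.single e 1) Z"
      by (auto simp: stanley_space_def carrier_poly_ring simp flip: mpoly_eq_sum_single)
  qed
qed

lemma additive_subgroup_mspan:
  assumes "C \<subseteq> A"
  shows "additive_subgroup (mspan C :: ('k::field) mpoly set) (ideal_module V (mspan A))"
proof (rule additive_subgroupI)
  interpret M: abelian_group "ideal_module V (mspan A) :: ('k mpoly, 'k mpoly) graded_module"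
    by (rule abelian_group_ideal_module)
  have minus: "\<ominus>\<^bsub>ideal_module V (mspan A)\<^esub> p = - p" if "p \<in> mspan A" for p :: "'k mpoly"
    using that M.minus_equality[of "- p" p] by simp
  show "subgroup (mspan C :: 'k mpoly set) (add_monoid (ideal_module V (mspan A)))"
  proof (rule M.add.subgroupI)
    show "mspan C \<subseteq> (carrier (ideal_module V (mspan A)) :: 'k mpoly set)"
      using assms by (simp add: mspan_mono)
    then show "\<ominus>\<^bsub>ideal_module V (mspan A)\<^esub> p \<in> mspan C" if "p \<in> mspan C" for p :: "'k mpoly"
      using that minus by (auto simp: subset_iff)
    show "(mspan C :: 'k mpoly set) \<noteq> {}"
      using mspan_zero by blast
  qed (auto intro: mspan_add)
qed

text \<open>Existence: group the terms of a polynomial by the block that contains their exponent.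
  Uniqueness: at a given exponent only one block can have a nonzero coefficient, so nothing cancels
  between blocks.\<close>

lemma internal_direct_sum_mspan:
  assumes "finite T" "disjoint_family_on C T" "(\<Union>i\<in>T. C i) = A"
  shows "internal_direct_sum (ideal_module V (mspan A)) T (\<lambda>i. mspan (C i) :: ('k::field) mpoly set)"
  unfolding internal_direct_sum_def
proof (intro conjI ballI allI impI)
  fix i assume "i \<in> T"
  then show "additive_subgroup (mspan (C i) :: 'k mpoly set) (ideal_module V (mspan A))"
    using assms(3) by (intro additive_subgroup_mspan) auto
next
  fix p :: "'k mpoly" assume "p \<in> carrier (ideal_module V (mspan A))"
  then have p: "Poly_Mapping.keys p \<subseteq> A"
    by (simp add: mspan_def)
  let ?s = "\<lambda>e. Poly_Mapping.single e (Poly_Mapping.lookup p e)"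
  let ?y = "\<lambda>i. sum ?s (Poly_Mapping.keys p \<inter> C i)"
  have y: "?y i \<in> mspan (C i)" for i
    by (intro mspan_sum) (simp add: single_in_mspan_iff)
  have yA: "?y i \<in> mspan A" if "i \<in> T" for i
    using y[of i] mspan_mono[of "C i" A] assms(3) that by blast
  have "p = sum ?s (\<Union>i\<in>T. Poly_Mapping.keys p \<inter> C i)"
    using mpoly_eq_sum_single[of p] p assms(3) by (simp add: Int_absorb2 flip: Int_UN_distrib)
  also have "\<dots> = sum ?y T"
    using assms(1,2) by (intro sum.UNION_disjoint) (auto simp: disjoint_family_on_def)
  also have "\<dots> = (\<Oplus>\<^bsub>ideal_module V (mspan A)\<^esub>i\<in>T. ?y i)"
    using assms(1) yA by (simp add: finsum_ideal_module)
  finally show "\<exists>F y. finite F \<and> F \<subseteq> T \<and> y \<in> Pi F (\<lambda>i. mspan (C i)) \<and>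
      p = (\<Oplus>\<^bsub>ideal_module V (mspan A)\<^esub>i\<in>F. y i)"
    using y assms(1) by (intro exI[of _ T] exI[of _ ?y]) simp
next
  fix F and y :: "_ \<Rightarrow> 'k mpoly" and i
  assume *: "finite F \<and> F \<subseteq> T \<and> y \<in> Pi F (\<lambda>i. mspan (C i)) \<and>
      (\<Oplus>\<^bsub>ideal_module V (mspan A)\<^esub>i\<in>F. y i) = \<zero>\<^bsub>ideal_module V (mspan A)\<^esub>" and i: "i \<in> F"
  then have y: "y j \<in> mspan (C j)" "y j \<in> mspan A" if "j \<in> F" for j
    using that mspan_mono[of "C j" A] assms(3) by blast+
  have sum: "sum y F = 0"
    using * y(2) finsum_ideal_module[of F y A V] by simp
  have "t \<notin> Poly_Mapping.keys (y i)" for t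
  proof
    assume t: "t \<in> Poly_Mapping.keys (y i)"
    have "Poly_Mapping.lookup (y j) t = 0" if j: "j \<in> F - {i}" for j
    proof -
      have "C i \<inter> C j = {}"
        using assms(2) j i * by (auto simp: disjoint_family_on_def)
      then have "t \<notin> Poly_Mapping.keys (y j)"
        using t y(1)[OF i] y(1)[of j] j unfolding mspan_def by blast
      then show ?thesis
        by (simp add: in_keys_iff)
    qed
    then have "(\<Sum>j\<in>F. Poly_Mapping.lookup (y j) t) = Poly_Mapping.lookup (y i) t"
      using * i by (simp add: sum.remove)
    moreover have "(\<Sum>j\<in>F. Poly_Mapping.lookup (y j) t) = 0"
      using arg_cong[OF sum, of "\<lambda>p. Poly_Mapping.lookup p t"] by (simp add: lookup_sum)
    ultimately show False
      using t by (simp add: in_keys_iff)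
  qed
  then have "Poly_Mapping.keys (y i) = {}"
    by blast
  then show "y i = \<zero>\<^bsub>ideal_module V (mspan A)\<^esub>"
    using mpoly_eq_sum_single[of "y i"] by simp
qed

lemma stanley_decomposition_of_cone_partition:
  assumes "cone_partition V S A" "A \<subseteq> exps V"
  shows "\<exists>D. stanley_decomposition V (ideal_module V (mspan A :: ('k::field) mpoly set)) D \<and>
    set D = (\<lambda>(e, Z). (Poly_Mapping.single e 1, Z)) ` S"
proof -
  have S: "finite S" "\<And>e Z. (e, Z) \<in> S \<Longrightarrow> Z \<subseteq> V" "\<And>e Z. (e, Z) \<in> S \<Longrightarrow> cone e Z \<subseteq> A"
    "disjoint_family_on (\<lambda>(e, Z). cone e Z) S" "(\<Union>(e, Z)\<in>S. cone e Z) = A"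
    using assms(1) by (auto simp: cone_partition_def)
  \<comment> \<open>The enumeration has no repetitions, so different indices give different pairs
    and hence disjoint cones.\<close>
  obtain L where L: "set L = S" "distinct L"
    using finite_distinct_list[OF S(1)] by blast
  let ?M = "ideal_module V (mspan A :: 'k mpoly set)"
  let ?D = "map (\<lambda>(e, Z). (Poly_Mapping.single e (1::'k), Z)) L"
  let ?C = "\<lambda>i. cone (fst (L ! i)) (snd (L ! i))"
  have "\<exists>a\<in>degrees V. Poly_Mapping.single e 1 \<in> hpart ?M a" if "(e, Z) \<in> S" for e Z
  proof (rule bexI)
    have e: "e \<in> A"
      using S(3)[OF that] by auto
    then show "(\<lambda>v. int (Poly_Mapping.lookup e v)) \<in> degrees V"
      using assms(2) by (auto simp: degrees_def exps_iff)
    show "Poly_Mapping.single e 1 \<in> hpart ?M (\<lambda>v. int (Poly_Mapping.lookup e v))"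
      using e by (simp add: ideal_module_def single_in_mspan_iff)
  qed
  moreover have "internal_direct_sum ?M {..<length ?D}
      (\<lambda>i. stanley_space ?M (fst (?D ! i)) (snd (?D ! i)))"
  proof -
    have "?C i \<inter> ?C j = {}" if "i < length L" "j < length L" "i \<noteq> j" for i j
      using disjoint_family_onD[OF S(4), of "L ! i" "L ! j"] nth_mem[OF that(1)] nth_mem[OF that(2)]
        that L by (simp add: split_beta nth_eq_iff_index_eq)
    then have disj: "disjoint_family_on ?C {..<length L}"
      by (simp add: disjoint_family_on_def)
    have "set L = (!) L ` {..<length L}"
      by (auto simp: set_conv_nth)
    then have "(\<Union>i\<in>{..<length L}. ?C i) = A"
      using S(5) L(1) by (simp add: split_beta)
    then have "internal_direct_sum ?M {..<length L} (\<lambda>i. mspan (?C i))"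
      using disj by (intro internal_direct_sum_mspan) auto
    moreover have "stanley_space ?M (fst (?D ! i)) (snd (?D ! i)) = mspan (?C i)"
      if "i \<in> {..<length L}" for i
      using that by (simp add: split_beta stanley_space_monomial)
    ultimately show ?thesis
      by (simp add: internal_direct_sum_def Pi_def subset_iff cong: conj_cong)
  qed
  \<comment> \<open>Freeness of each generator holds because a product of a nonzero polynomial with
    a monomial is nonzero.\<close>
  ultimately have "stanley_decomposition V ?M ?D"
    unfolding stanley_decomposition_def by (auto simp: L(1) intro: subsetD[OF S(2)])
  then show ?thesis
    using L(1) by (intro exI[of _ ?D]) simp
qed

section \<open>Bounds for the Stanley depth and its attainment\<close>

lemma stanley_decomposition_nonempty:
  assumes "abelian_monoid M" "stanley_decomposition V M D" "carrier M \<noteq> {\<zero>\<^bsub>M\<^esub>}"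
  shows "D \<noteq> []"
proof
  interpret M: abelian_monoid M by fact
  assume "D = []"
  then have "x = \<zero>\<^bsub>M\<^esub>" if "x \<in> carrier M" for x
    using assms(2) that by (fastforce simp: stanley_decomposition_def internal_direct_sum_def)
  then show False
    using assms(3) M.zero_closed by blast
qed

text \<open>This bounds the set whose supremum is \<open>sdepth\<close>, so that the supremum is an
  upper bound and, if the set is nonempty, a maximum. For a nonzero module the list \<open>D\<close>
  is nonempty, hence the \<open>Min\<close> is a genuine minimum.\<close>

lemma sdepth_decomp_le_card:
  assumes "abelian_monoid M" "stanley_decomposition V M D" "carrier M \<noteq> {\<zero>\<^bsub>M\<^esub>}" "finite V"
  shows "sdepth_decomp D \<le> card V"
proof -
  obtain m Z where mZ: "(m, Z) \<in> set D"
    using stanley_decomposition_nonempty[OF assms(1-3)] by (cases D) auto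
  then have "sdepth_decomp D \<le> card Z"
    unfolding sdepth_decomp_def by (intro Min_le) (auto simp: image_iff intro: rev_bexI)
  also have "\<dots> \<le> card V"
    using assms(2,4) mZ by (auto simp: stanley_decomposition_def intro!: card_mono)
  finally show ?thesis .
qed

lemma sdepth_ge:
  assumes "abelian_monoid M" "carrier M \<noteq> {\<zero>\<^bsub>M\<^esub>}" "finite V"
    and "stanley_decomposition V M D" "\<And>m Z. (m, Z) \<in> set D \<Longrightarrow> c \<le> card Z"
  shows "c \<le> sdepth V M"
proof -
  have "c \<le> sdepth_decomp D"
    unfolding sdepth_decomp_def
    using stanley_decomposition_nonempty[OF assms(1,4,2)] assms(5) by (intro Min.boundedI) auto
  also have "\<dots> \<le> sdepth V M"
    unfolding sdepth_def using assms(4) sdepth_decomp_le_card[OF assms(1) _ assms(2,3)]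
    by (intro cSup_upper bdd_aboveI[of _ "card V"]) auto
  finally show ?thesis .
qed

text \<open>On the natural numbers the supremum of the empty set is \<open>0\<close>. A positive
  depth thus already provides a decomposition, and a finite nonempty set of values contains its
  supremum.\<close>

lemma sdepth_attained:
  assumes "abelian_monoid M" "carrier M \<noteq> {\<zero>\<^bsub>M\<^esub>}" "finite V" "0 < sdepth V M"
  obtains D where "stanley_decomposition V M D" "sdepth_decomp D = sdepth V M"
proof -
  let ?X = "{sdepth_decomp D |D. stanley_decomposition V M D}"
  have "finite ?X"
    using sdepth_decomp_le_card[OF assms(1) _ assms(2,3)]
    by (intro finite_subset[of ?X "{..card V}"]) auto
  moreover have "?X \<noteq> {}"
    using assms(4) unfolding sdepth_def by (metis Sup_nat_empty less_irrefl)
  ultimately have "sdepth V M \<in> ?X"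
    unfolding sdepth_def by (subst cSup_eq_Max) (auto intro: Max_in simp del: mem_Collect_eq)
  then show thesis
    using that by auto
qed

section \<open>Cone partitions from the depth of an ideal and of a quotient\<close>

lemma cone_partition_of_sdepth_ideal_module:
  assumes "A \<noteq> {}" "exps V + A \<subseteq> A" "finite V"
    and "0 < c" "c \<le> sdepth V (ideal_module V (mspan A :: ('k::field) mpoly set))"
  shows "\<exists>S. cone_partition V S A \<and> (\<forall>p\<in>S. c \<le> card (snd p))"
proof -
  let ?M = "ideal_module V (mspan A :: 'k mpoly set)"
  have M: "abelian_monoid ?M"
    by (rule abelian_group.axioms(1)[OF abelian_group_ideal_module])
  have "carrier ?M \<noteq> {\<zero>\<^bsub>?M\<^esub>}"
    using mspan_nonzero[OF assms(1)] by simp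
  then obtain D where D: "stanley_decomposition V ?M D" "sdepth_decomp D = sdepth V ?M"
    using assms(3-5) by (auto intro: sdepth_attained[OF M])
  \<comment> \<open>The ideal is handled as a quotient by zero: \<open>mspan {}\<close> is
    \<open>{0}\<close>, and \<open>f\<close> is the identity.\<close>
  have "\<exists>S. cone_partition V S (A - {}) \<and> (\<forall>p\<in>S. sdepth_decomp D \<le> card (snd p))"
  proof (rule cone_partition_of_stanley_decomposition[OF M, of A "\<lambda>p. p"])
    show "p = \<zero>\<^bsub>?M\<^esub> \<longleftrightarrow> p \<in> mspan {}" for p :: "'k mpoly"
      by (simp add: mspan_def)
  qed (use assms(2) D(1) in simp_all)
  then show ?thesis
    using assms(5) D(2) by (metis (no_types, lifting) Diff_empty order_trans)
qed

lemma coset_ideal_module: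
  "mspan B +>\<^bsub>ideal_module V (mspan A)\<^esub> p = {q. q - p \<in> (mspan B :: ('k::field) mpoly set)}"
proof -
  have "q \<in> (\<lambda>b. b + p) ` mspan B" if "q - p \<in> mspan B" for q
    using that by (intro image_eqI[of _ _ "q - p"]) auto
  then show ?thesis
    by (auto simp: a_r_coset_def')
qed

lemma cone_partition_of_sdepth_quot_module:
  assumes "A - B \<noteq> {}" "exps V + A \<subseteq> A" "exps V + B \<subseteq> B" "finite V"
    and "0 < c"
    and "c \<le> sdepth V (quot_module (ideal_module V (mspan A :: ('k::field) mpoly set)) (mspan B))"
  shows "\<exists>S. cone_partition V S (A - B) \<and> (\<forall>p\<in>S. c \<le> card (snd p))"
proof -
  let ?P = "ideal_module V (mspan A :: 'k mpoly set)"
  let ?M = "quot_module ?P (mspan B)"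
  \<comment> \<open>The coset of \<open>p\<close> is written through differences, so that equality
    of cosets becomes membership in \<open>mspan B\<close>.\<close>
  let ?f = "\<lambda>p. {q. q - p \<in> (mspan B :: 'k mpoly set)}"
  have coset_eq: "?f p = ?f p' \<longleftrightarrow> p - p' \<in> mspan B" for p p'
  proof
    assume "?f p = ?f p'"
    moreover have "p \<in> ?f p"
      by simp
    ultimately show "p - p' \<in> mspan B"
      by blast
  next
    assume "p - p' \<in> mspan B"
    then have "q - p \<in> mspan B \<longleftrightarrow> q - p' \<in> mspan B" for q
      using mspan_add[of "q - p" B "p - p'"] mspan_diff[of "q - p'" B "p - p'"] by auto
    then show "?f p = ?f p'"
      by simp
  qed
  have carrier: "carrier ?M = ?f ` mspan A"
    by (auto simp: quot_module_def A_RCOSETS_def' coset_ideal_module)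
  have zero: "\<zero>\<^bsub>?M\<^esub> = ?f 0"
    by (simp add: quot_module_def)
  have add: "?f p \<oplus>\<^bsub>?M\<^esub> ?f q = ?f (p + q)" for p q
  proof -
    have "x + y - (p + q) \<in> mspan B" if "x - p \<in> mspan B" "y - q \<in> mspan B" for x y
      using mspan_add[OF that] by (simp add: algebra_simps)
    moreover have "\<exists>x. x - p \<in> mspan B \<and> (\<exists>y. y - q \<in> mspan B \<and> z = x + y)"
      if "z - (p + q) \<in> mspan B" for z
      using that by (intro exI[of _ "z - q"] conjI exI[of _ q]) (simp_all add: algebra_simps)
    ultimately show ?thesis
      by (auto simp: quot_module_def set_add_def')
  qed
  have smult: "u \<odot>\<^bsub>?M\<^esub> ?f p = ?f (u * p)" if "u \<in> mspan (exps V)" for u p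
  proof -
    \<comment> \<open>Scalar multiplication is a union over all representatives. Since
      \<open>B\<close> is closed under adding exponents from \<open>V\<close>, each of them
      contributes the same coset.\<close>
    have "?f (u * x) = ?f (u * p)" if x: "x \<in> ?f p" for x
    proof -
      have "u * (x - p) \<in> mspan B"
        using mspan_mult[OF \<open>u \<in> mspan (exps V)\<close>, of "x - p" B] mspan_mono[OF assms(3)] x by auto
      then show ?thesis
        by (subst coset_eq) (simp add: algebra_simps)
    qed
    moreover have "p \<in> ?f p"
      by simp
    ultimately have "(\<Union>x\<in>?f p. ?f (u * x)) = ?f (u * p)"
      by blast
    then show ?thesis
      by (simp add: quot_module_def coset_ideal_module)
  qed
  have M: "abelian_monoid ?M"
  proof (rule abelian_monoidI)
    fix X Y assume "X \<in> carrier ?M" "Y \<in> carrier ?M"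
    then show "X \<oplus>\<^bsub>?M\<^esub> Y \<in> carrier ?M"
      unfolding carrier by (auto simp: add intro!: imageI mspan_add)
  next
    show "\<zero>\<^bsub>?M\<^esub> \<in> carrier ?M"
      unfolding carrier zero by (rule imageI) simp
  qed (unfold carrier zero, auto simp only: add ac_simps add_0_right)
  obtain e where e: "e \<in> A" "e \<notin> B"
    using assms(1) by blast
  have "?f (Poly_Mapping.single e 1) \<in> carrier ?M" "?f (Poly_Mapping.single e 1) \<noteq> \<zero>\<^bsub>?M\<^esub>"
    unfolding carrier zero coset_eq using e by (auto simp: single_in_mspan_iff)
  then have "carrier ?M \<noteq> {\<zero>\<^bsub>?M\<^esub>}"
    by blast
  then obtain D where D: "stanley_decomposition V ?M D" "sdepth_decomp D = sdepth V ?M"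
    using assms(4-6) by (auto intro: sdepth_attained[OF M])
  have "\<exists>S. cone_partition V S (A - B) \<and> (\<forall>p\<in>S. sdepth_decomp D \<le> card (snd p))"
  proof (rule cone_partition_of_stanley_decomposition[OF M, of A ?f])
    show "?f p = \<zero>\<^bsub>?M\<^esub> \<longleftrightarrow> p \<in> mspan B" for p
      unfolding zero coset_eq by simp
    show "hpart ?M a = ?f ` hpart ?P a" for a
      by (simp add: quot_module_def coset_ideal_module)
  qed (use carrier add smult assms(2) D(1) in auto)
  then show ?thesis
    using assms(6) D(2) by (metis (no_types, lifting) order_trans)
qed


section \<open>Powers of a sum in disjoint variables\<close>

lemma sum_sets_subset_exps: "E \<subseteq> exps V \<Longrightarrow> (\<Sum>i<k. E) \<subseteq> exps V" for k :: nat
  by (induction k) (auto elim!: set_plus_elim)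

lemma sum_sets_nonempty: "E \<noteq> {} \<Longrightarrow> (\<Sum>i<k. E) \<noteq> {}" for k :: nat
  by (induction k) (auto simp: set_plus_def)

text \<open>A monomial lies in the ideal generated by monomials exactly when one of the generators
  divides it; the quotient is the difference of exponents.\<close>

lemma exps_plus_iff:
  assumes "E \<subseteq> exps V"
  shows "t \<in> exps V + E \<longleftrightarrow>
    t \<in> exps V \<and> (\<exists>e\<in>E. \<forall>v. Poly_Mapping.lookup e v \<le> Poly_Mapping.lookup t v)"
proof
  assume "t \<in> exps V + E"
  then obtain u e where "t = u + e" "u \<in> exps V" "e \<in> E"
    by (rule set_plus_elim)
  then show "t \<in> exps V \<and> (\<exists>e\<in>E. \<forall>v. Poly_Mapping.lookup e v \<le> Poly_Mapping.lookup t v)"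
    using assms by (auto simp: lookup_add intro!: bexI[of _ e])
next
  assume "t \<in> exps V \<and> (\<exists>e\<in>E. \<forall>v. Poly_Mapping.lookup e v \<le> Poly_Mapping.lookup t v)"
  then obtain e where e: "t \<in> exps V" "e \<in> E" "\<And>v. Poly_Mapping.lookup e v \<le> Poly_Mapping.lookup t v"
    by blast
  then have t: "t = (t - e) + e"
    by (intro poly_mapping_eqI) (simp add: lookup_add lookup_minus)
  have "t - e \<in> exps V"
    using e(1) by (simp add: exps_iff lookup_minus)
  then show "t \<in> exps V + E"
    using set_plus_intro[of "t - e" "exps V" e E] e(2) t by simp
qed

text \<open>At every variable one of \<open>e\<close> and \<open>f\<close> vanishes, so
  \<open>x^(e+f)\<close> divides a monomial if and only if \<open>x^e\<close> and \<open>x^f\<close>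
  both do. In terms of ideals, product and intersection agree.\<close>

lemma exps_plus_Int:
  assumes "E \<subseteq> exps X" "F \<subseteq> exps Y" "X \<inter> Y = {}" "X \<union> Y \<subseteq> V"
  shows "exps V + (E + F) = (exps V + E) \<inter> (exps V + F)"
proof -
  have EF: "E \<subseteq> exps V" "F \<subseteq> exps V"
    using assms exps_mono[of X V] exps_mono[of Y V] by auto
  then have sum: "E + F \<subseteq> exps V"
    by (auto elim!: set_plus_elim)
  have le: "(\<forall>v. Poly_Mapping.lookup (e + f) v \<le> Poly_Mapping.lookup t v) \<longleftrightarrow>
      (\<forall>v. Poly_Mapping.lookup e v \<le> Poly_Mapping.lookup t v) \<and>
      (\<forall>v. Poly_Mapping.lookup f v \<le> Poly_Mapping.lookup t v)"
    if "e \<in> E" "f \<in> F" for e f t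
  proof -
    have "Poly_Mapping.lookup e v = 0 \<or> Poly_Mapping.lookup f v = 0" for v
      using that assms(1-3) by (cases "v \<in> X") (auto simp: exps_iff subset_iff disjoint_iff)
    then have "Poly_Mapping.lookup (e + f) v \<le> Poly_Mapping.lookup t v \<longleftrightarrow>
        Poly_Mapping.lookup e v \<le> Poly_Mapping.lookup t v \<and>
        Poly_Mapping.lookup f v \<le> Poly_Mapping.lookup t v" for v
      by (metis add.left_neutral add.right_neutral lookup_add zero_le)
    then show ?thesis
      by blast
  qed
  have "(\<exists>g\<in>E + F. \<forall>v. Poly_Mapping.lookup g v \<le> Poly_Mapping.lookup t v) \<longleftrightarrow>
      (\<exists>e\<in>E. \<exists>f\<in>F. \<forall>v. Poly_Mapping.lookup (e + f) v \<le> Poly_Mapping.lookup t v)" for t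
    by (auto simp: set_plus_def)
  moreover have "(\<exists>e\<in>E. \<exists>f\<in>F. \<forall>v. Poly_Mapping.lookup (e + f) v \<le> Poly_Mapping.lookup t v) \<longleftrightarrow> (\<exists>e\<in>E. \<exists>f\<in>F.
      (\<forall>v. Poly_Mapping.lookup e v \<le> Poly_Mapping.lookup t v) \<and>
      (\<forall>v. Poly_Mapping.lookup f v \<le> Poly_Mapping.lookup t v))" for t
    by (intro bex_cong refl le)
  ultimately show ?thesis
    unfolding set_eq_iff Int_iff exps_plus_iff[OF EF(1)] exps_plus_iff[OF EF(2)] exps_plus_iff[OF sum]
    by blast
qed

section \<open>Decreasing powers, the expansion of a power of a sum, and its partition\<close>

lemma antimono_exps_plus_sum:
  assumes "E \<subseteq> exps V"
  shows "antimono (\<lambda>k::nat. exps V + (\<Sum>i<k. E))"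
unfolding antimono_iff_le_Suc
proof
  fix k
  have "exps V + (\<Sum>i<Suc k. E) = (exps V + E) + (\<Sum>i<k. E)"
    by (simp add: ac_simps)
  also have "\<dots> \<subseteq> exps V + (\<Sum>i<k. E)"
    using assms by (intro set_plus_mono2) (auto elim!: set_plus_elim)
  finally show "exps V + (\<Sum>i<Suc k. E) \<subseteq> exps V + (\<Sum>i<k. E)" .
qed

lemma UN_set_plus: "(\<Union>i\<in>T. A i) + B = (\<Union>i\<in>T. A i + B)"
  and set_plus_UN: "B + (\<Union>i\<in>T. A i) = (\<Union>i\<in>T. B + A i)"
  by (auto simp: set_plus_def)

text \<open>This is the binomial expansion for sumsets, with union in the place of addition and so
  without coefficients. In the induction a further summand from \<open>E\<close> keeps the index
  \<open>i\<close>, and one from \<open>F\<close> raises it by one.\<close>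

lemma sum_sets_Un:
  fixes E F :: "'a::comm_monoid_add set" and n :: nat
  shows "(\<Sum>i<n. E \<union> F) = (\<Union>i\<le>n. (\<Sum>j<n - i. E) + (\<Sum>j<i. F))"
proof (induction n)
  case 0
  then show ?case
    by simp
next
  case (Suc n)
  let ?T = "\<lambda>k i. (\<Sum>j<k. E) + (\<Sum>j<i. F)"
  have E: "?T (n - i) i + E = ?T (Suc n - i) i" if "i \<le> n" for i
    using that by (simp add: Suc_diff_le ac_simps)
  have F: "?T (n - i) i + F = ?T (Suc n - Suc i) (Suc i)" for i
    by (simp add: ac_simps)
  have "(\<Sum>i<Suc n. E \<union> F) = (\<Union>i\<le>n. ?T (n - i) i) + (E \<union> F)"
    using Suc by simp
  also have "\<dots> = (\<Union>i\<le>n. ?T (n - i) i + E) \<union> (\<Union>i\<le>n. ?T (n - i) i + F)"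
    by (simp only: UN_set_plus set_plus_Un)
  also have "\<dots> = (\<Union>i\<le>n. ?T (Suc n - i) i) \<union> (\<Union>i\<le>n. ?T (Suc n - Suc i) (Suc i))"
    using E by (simp only: F) simp
  also have "\<dots> = (\<Union>i\<le>Suc n. ?T (Suc n - i) i)"
  proof -
    \<comment> \<open>The terms obtained from \<open>E\<close> have indices \<open>0\<close> to
      \<open>n\<close>, those obtained from \<open>F\<close> have indices \<open>1\<close> to
      \<open>n + 1\<close>. The first family misses only the top index, which the second one
      supplies.\<close>
    have "A \<union> B = C" if "B \<subseteq> C" "C = A \<union> D" "D \<subseteq> B" for A B C D :: "'a set"
      using that by blast
    note Un_eq = this
    show ?thesis
    proof (rule Un_eq)
      show "(\<Union>i\<le>n. ?T (Suc n - Suc i) (Suc i)) \<subseteq> (\<Union>i\<le>Suc n. ?T (Suc n - i) i)"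
        by (rule UN_least, rule UN_upper) simp
      show "(\<Union>i\<le>Suc n. ?T (Suc n - i) i) = (\<Union>i\<le>n. ?T (Suc n - i) i) \<union> ?T (Suc n - Suc n) (Suc n)"
        unfolding atMost_Suc UN_insert by (rule Un_commute)
      show "?T (Suc n - Suc n) (Suc n) \<subseteq> (\<Union>i\<le>n. ?T (Suc n - Suc i) (Suc i))"
        by (rule UN_upper) simp
    qed
  qed
  finally show ?case .
qed

text \<open>An element of the union is assigned to the least \<open>i\<close> with \<open>t \<in> a (n - i) \<inter> b i\<close>.\<close>

lemma antimono_filtration:
  fixes a b :: "nat \<Rightarrow> 'a set"
  assumes "antimono a" "antimono b" "a n \<subseteq> b 0"
  defines "G \<equiv> \<lambda>i. if i = 0 then a n else a (n - i) \<inter> b i - a (n - i + 1) \<inter> b i"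
  shows "(\<Union>i\<le>n. G i) = (\<Union>i\<le>n. a (n - i) \<inter> b i)" and "disjoint_family_on G {..n}"
proof -
  show "(\<Union>i\<le>n. G i) = (\<Union>i\<le>n. a (n - i) \<inter> b i)"
  proof
    show "(\<Union>i\<le>n. G i) \<subseteq> (\<Union>i\<le>n. a (n - i) \<inter> b i)"
      using assms(3) by (intro UN_mono) (auto simp: G_def)
    show "(\<Union>i\<le>n. a (n - i) \<inter> b i) \<subseteq> (\<Union>i\<le>n. G i)"
    proof
      fix t assume t: "t \<in> (\<Union>i\<le>n. a (n - i) \<inter> b i)"
      define i where "i = (LEAST i. i \<le> n \<and> t \<in> a (n - i) \<inter> b i)"
      have i: "i \<le> n" "t \<in> a (n - i)" "t \<in> b i"
        using t LeastI_ex[of "\<lambda>i. i \<le> n \<and> t \<in> a (n - i) \<inter> b i"] unfolding i_def by auto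
      \<comment> \<open>Otherwise \<open>i - 1\<close> would also qualify, because \<open>b\<close>
        is decreasing, against the choice of \<open>i\<close> as the least index.\<close>
      have "t \<notin> a (n - i + 1)" if "i \<noteq> 0"
      proof -
        have "t \<in> b (i - 1)"
          using antimonoD[OF assms(2), of "i - 1" i] i(3) by auto
        moreover have "\<not> (i - 1 \<le> n \<and> t \<in> a (n - (i - 1)) \<inter> b (i - 1))"
          using not_less_Least[of "i - 1" "\<lambda>i. i \<le> n \<and> t \<in> a (n - i) \<inter> b i"] that
          unfolding i_def by simp
        moreover have "n - (i - 1) = n - i + 1"
          using i(1) that by simp
        moreover have "i - 1 \<le> n"
          using i(1) by simp
        ultimately show ?thesis
          by (metis IntI)
      qed
      then have "t \<in> G i"
        using i by (auto simp: G_def)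
      then show "t \<in> (\<Union>i\<le>n. G i)"
        using i(1) by blast
    qed
  qed
  \<comment> \<open>From \<open>i < j\<close> follows \<open>n - j + 1 \<le> n - i\<close>, so
    \<open>G i\<close> lies in the very set that is removed in \<open>G j\<close>.\<close>
  have "G i \<inter> G j = {}" if "i < j" "j \<le> n" for i j
  proof -
    have "G i \<subseteq> a (n - i)"
      by (auto simp: G_def)
    also have "\<dots> \<subseteq> a (n - j + 1)"
      using that by (intro antimonoD[OF assms(1)]) simp
    finally show ?thesis
      using that(1) by (auto simp: G_def)
  qed
  then show "disjoint_family_on G {..n}"
    unfolding disjoint_family_on_def by (metis atMost_iff inf_commute linorder_neqE_nat)
qed

text \<open>An element of \<open>k E\<close> of least degree is not divisible by an element of \<open>(k + 1) E\<close>.\<close>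

lemma exps_plus_sum_strict:
  assumes "finite X" "E \<subseteq> exps X" "E \<noteq> {}" "0 \<notin> E"
    and "F \<subseteq> exps Y" "F \<noteq> {}" "X \<inter> Y = {}" "X \<union> Y \<subseteq> V"
  shows "(exps V + (\<Sum>j<k. E)) \<inter> (exps V + F) - (exps V + (\<Sum>j<Suc k. E)) \<inter> (exps V + F) \<noteq> {}"
proof -
  \<comment> \<open>Only the variables in \<open>X\<close> are counted, so an exponent vector from
    \<open>F\<close> contributes nothing.\<close>
  define deg where "deg e = (\<Sum>v\<in>X. Poly_Mapping.lookup e v)" for e :: "nat \<Rightarrow>\<^sub>0 nat"
  have E: "(\<Sum>j<l. E) \<subseteq> exps X" for l :: nat
    using assms(2) by (rule sum_sets_subset_exps)
  have V: "exps X \<subseteq> exps V" "exps Y \<subseteq> exps V"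
    using assms(8) by (auto intro!: exps_mono)
  obtain e where e: "e \<in> (\<Sum>j<k. E)" and min: "\<And>e'. e' \<in> (\<Sum>j<k. E) \<Longrightarrow> deg e \<le> deg e'"
    using sum_sets_nonempty[OF assms(3), of k] ex_has_least_nat[of "\<lambda>e. e \<in> (\<Sum>j<k. E)" _ deg]
    by blast
  obtain f where f: "f \<in> F"
    using assms(6) by blast
  have "e \<in> exps V" "f \<in> exps V"
    using e f E[of k] assms(5) V by auto
  then have mem: "f + e \<in> exps V + (\<Sum>j<k. E)" "e + f \<in> exps V + F"
    using e f by (auto intro: set_plus_intro)
  \<comment> \<open>A divisor \<open>e' + h\<close> of \<open>e + f\<close> would give
    \<open>deg e' + deg h \<le> deg e\<close>. Since \<open>h\<close> is nonzero with variables in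
    \<open>X\<close>, its degree is positive, and \<open>e\<close> would not be minimal.\<close>
  have "e + f \<notin> exps V + (\<Sum>j<Suc k. E)"
  proof
    assume "e + f \<in> exps V + (\<Sum>j<Suc k. E)"
    then obtain g where g: "g \<in> (\<Sum>j<k. E) + E"
      "\<And>v. Poly_Mapping.lookup g v \<le> Poly_Mapping.lookup (e + f) v"
      using exps_plus_iff[of "\<Sum>j<Suc k. E" V "e + f"] E[of "Suc k"] V(1) by auto
    from g(1) obtain e' h where h: "g = e' + h" "e' \<in> (\<Sum>j<k. E)" "h \<in> E"
      by (rule set_plus_elim)
    have "Poly_Mapping.lookup f v = 0" if "v \<in> X" for v
      using f assms(5,7) that by (auto simp: exps_iff subset_iff)
    then have "deg g \<le> deg e"
      unfolding deg_def using g(2) by (intro sum_mono) (metis add.right_neutral lookup_add)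
    moreover have "deg g = deg e' + deg h"
      by (simp add: deg_def h(1) lookup_add sum.distrib)
    moreover have "deg h \<noteq> 0"
    proof
      assume "deg h = 0"
      then have "h = 0"
        using assms(1,2) h(3) by (intro poly_mapping_eqI) (auto simp: deg_def exps_iff subset_iff)
      then show False
        using assms(4) h(3) by simp
    qed
    ultimately show False
      using min[OF h(2)] by simp
  qed
  with mem show ?thesis
    unfolding add.commute[of f e] by blast
qed

section \<open>Generators of the extended ideals and the final inequality\<close>

lemma monomial_ideal_generators:
  assumes "monomial_ideal X I" "I \<noteq> {0}" "I \<noteq> carrier (poly_ring X)" "X \<subseteq> V"
  obtains E where "E \<subseteq> exps X" "E \<noteq> {}" "0 \<notin> E"
    "Idl\<^bsub>poly_ring V\<^esub> I = (mspan (exps V + E) :: ('k::field) mpoly set)"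
proof -
  obtain E where E: "E \<subseteq> exps X"
    and I: "I = Idl\<^bsub>poly_ring X\<^esub> ((\<lambda>e. Poly_Mapping.single e (1::'k)) ` E)"
    using assms(1) by (auto simp: monomial_ideal_def exps_def)
  have sub: "E \<subseteq> exps Z + E" for Z
    using set_plus_intro[of 0 "exps Z" _ E] by auto
  have "(\<lambda>e. Poly_Mapping.single e (1::'k)) ` E \<subseteq> mspan (exps X + E)"
    using sub[of X] by (auto simp: single_in_mspan_iff)
  then have I': "I = mspan (exps X + E)"
    unfolding I by (intro genideal_mspan[OF E]) auto
  \<comment> \<open>Nonzero and proper turn into conditions on the exponents: without generators the
    ideal is zero, and the generator \<open>1\<close>, with exponent \<open>0\<close>, would give
    the whole ring.\<close>
  have "E \<noteq> {}"
    using assms(2) by (auto simp: I' mspan_def)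
  moreover have "0 \<notin> E"
  proof
    assume "0 \<in> E"
    then have "exps X + E = exps X"
      using E set_plus_intro[of _ "exps X" 0 E] by (fastforce elim!: set_plus_elim)
    then show False
      using assms(3) by (simp add: I' carrier_poly_ring)
  qed
  moreover have "Idl\<^bsub>poly_ring V\<^esub> I = mspan (exps V + E)"
  proof (rule genideal_mspan)
    show "E \<subseteq> exps V"
      using E exps_mono[OF assms(4)] by blast
    show "(\<lambda>e. Poly_Mapping.single e 1) ` E \<subseteq> I"
      using sub[of X] by (auto simp: I' single_in_mspan_iff)
    show "I \<subseteq> mspan (exps V + E)"
      unfolding I' using exps_mono[OF assms(4)] by (intro mspan_mono set_plus_mono2) auto
  qed
  ultimately show thesis
    using that E by blast
qed

theorem proposition2p6:
  fixes r s n :: nat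
    and I J :: "('k::field) mpoly set"
  assumes "r \<ge> 1" and "s \<ge> 1"
    and "monomial_ideal {1..r} I" and "I \<noteq> {0}" and "I \<noteq> carrier (poly_ring {1..r})"
    and "monomial_ideal {r+1..r+s} J" and "J \<noteq> {0}" and "J \<noteq> carrier (poly_ring {r+1..r+s})"
  shows "let V = {1..r+s};
             R = poly_ring V :: 'k mpoly ring;
             IR = Idl\<^bsub>R\<^esub> I;
             JR = Idl\<^bsub>R\<^esub> J;
             pow = (\<lambda>P (k::nat). P [^]\<^bsub>ideals_set R\<^esub> k)
         in sdepth V (ideal_module V (pow (IR <+>\<^bsub>R\<^esub> JR) n)) \<ge>
            Min ({sdepth V (ideal_module V (pow IR n))} \<union>
                 {sdepth V (quot_module (ideal_module V (pow IR (n - i) \<cdot>\<^bsub>R\<^esub> pow JR i))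
                                        (pow IR (n - i + 1) \<cdot>\<^bsub>R\<^esub> pow JR i)) |i. 1 \<le> i \<and> i \<le> n})"
proof -
  define X Y V where XYV: "X = {1..r}" "Y = {r+1..r+s}" "V = {1..r+s}"
  have disjoint: "X \<inter> Y = {}" "X \<union> Y \<subseteq> V" and finite: "finite X" "finite V"
    by (auto simp: XYV)
  let ?R = "poly_ring V :: 'k mpoly ring"
  let ?pow = "\<lambda>P (k::nat). P [^]\<^bsub>ideals_set ?R\<^esub> k"
  let ?IR = "Idl\<^bsub>?R\<^esub> I" and ?JR = "Idl\<^bsub>?R\<^esub> J"
  obtain E where E: "E \<subseteq> exps X" "E \<noteq> {}" "0 \<notin> E" "?IR = mspan (exps V + E)"
    using assms(3-5) disjoint(2) unfolding XYV(1)[symmetric]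
    by (elim monomial_ideal_generators[of X I V]) auto
  obtain F where F: "F \<subseteq> exps Y" "F \<noteq> {}" "?JR = mspan (exps V + F)"
    using assms(6-8) disjoint(2) unfolding XYV(2)[symmetric]
    by (elim monomial_ideal_generators[of Y J V]) auto
  have EF_V: "E \<subseteq> exps V" "F \<subseteq> exps V"
    using E(1) F(1) disjoint(2) exps_mono[of X V] exps_mono[of Y V] by auto
  \<comment> \<open>These are the exponents in the \<open>k\<close>th powers of the two extended
    ideals; both equal \<open>exps V\<close> for \<open>k = 0\<close>.\<close>
  define a b where ab: "a k = exps V + (\<Sum>i<k. E)" "b k = exps V + (\<Sum>i<k. F)" for k :: nat
  have up: "exps V + a k = a k" "exps V + b k = b k" for k
    by (simp_all add: ab flip: add.assoc)
  have Int: "exps V + ((\<Sum>j<k. E) + (\<Sum>j<i. F)) = a k \<inter> b i" for k i :: nat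
    unfolding ab using E(1) F(1) by (intro exps_plus_Int[OF _ _ disjoint] sum_sets_subset_exps)
  have prod: "?pow ?IR k \<cdot>\<^bsub>?R\<^esub> ?pow ?JR i = mspan (a k \<inter> b i)" for k i
  proof -
    have "a k + b i = exps V + exps V + ((\<Sum>j<k. E) + (\<Sum>j<i. F))"
      unfolding ab by (simp only: ac_simps)
    then show ?thesis
      by (simp add: E(4) F(3) ideal_pow_mspan ideal_prod_mspan Int flip: ab)
  qed
  define W where "W = exps V + (\<Sum>i<n. E \<union> F)"
  have sum: "?pow (?IR <+>\<^bsub>?R\<^esub> ?JR) n = mspan W"
    by (simp add: W_def E(4) F(3) set_add_mspan ideal_pow_mspan flip: set_plus_Un)
  have W: "W = (\<Union>i\<le>n. a (n - i) \<inter> b i)"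
    by (simp add: W_def sum_sets_Un set_plus_UN Int)
  \<comment> \<open>The piece at \<open>0\<close> is all of \<open>a n\<close>, belonging to the
    ideal \<open>I^n\<close>; the later pieces belong to the quotients.\<close>
  define G where "G i = (if i = 0 then a n else a (n - i) \<inter> b i - a (n - i + 1) \<inter> b i)" for i
  have mono: "antimono a" "antimono b"
    unfolding ab by (intro antimono_exps_plus_sum EF_V)+
  have a_exps: "a k \<subseteq> exps V" for k
    using antimonoD[OF mono(1), of 0 k] by (simp add: ab)
  note filtration = antimono_filtration[OF mono, of n, folded G_def]
  have b0: "a n \<subseteq> b 0"
    using a_exps by (simp add: ab)
  let ?d = "\<lambda>i. sdepth V (quot_module (ideal_module V (mspan (a (n - i) \<inter> b i) :: 'k mpoly set))
      (mspan (a (n - i + 1) \<inter> b i)))"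
  define c where "c = Min ({sdepth V (ideal_module V (mspan (a n) :: 'k mpoly set))} \<union>
      {?d i |i. 1 \<le> i \<and> i \<le> n})"
  have "c \<le> sdepth V (ideal_module V (mspan W :: 'k mpoly set))"
  \<comment> \<open>For \<open>c = 0\<close> the bound is trivial. A positive \<open>c\<close> makes
    the depth of every piece positive, which is what ensures that it is attained.\<close>
  proof (cases "c = 0")
    case False
    have fin: "finite ({sdepth V (ideal_module V (mspan (a n) :: 'k mpoly set))} \<union>
        {?d i |i. 1 \<le> i \<and> i \<le> n})"
      by simp
    have "\<exists>S. cone_partition V S (G i) \<and> (\<forall>p\<in>S. c \<le> card (snd p))" if "i \<le> n" for i
    proof (cases "i = 0")
      case True
      have "a n \<noteq> {}"
        using sum_sets_nonempty[OF E(2), of n] set_plus_intro[OF zero_in_exps] by (auto simp: ab)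
      moreover have "c \<le> sdepth V (ideal_module V (mspan (a n) :: 'k mpoly set))"
        unfolding c_def using fin by (intro Min_le) auto
      ultimately show ?thesis
        using cone_partition_of_sdepth_ideal_module[of "a n" V c] up False finite True
        by (simp add: G_def)
    next
      case i: False
      have "c \<le> ?d i"
        unfolding c_def using fin i that by (intro Min_le) auto
      \<comment> \<open>The quotient is nonzero because one more factor from \<open>E\<close>
        strictly shrinks the set of exponents, even after intersecting with
        \<open>b i\<close>.\<close>
      moreover have "a (n - i) \<inter> b i - a (n - i + 1) \<inter> b i \<noteq> {}"
        using exps_plus_sum_strict[OF finite(1) E(1-3) sum_sets_subset_exps[OF F(1)]
            sum_sets_nonempty[OF F(2)] disjoint, of "n - i" i]
        by (simp add: ab del: sum.lessThan_Suc)
      moreover have "exps V + (a k \<inter> b i) \<subseteq> a k \<inter> b i" for k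
        using up set_plus_mono2[of "exps V" "exps V"] by (metis Int_greatest inf_le1 inf_le2 order_refl)
      ultimately show ?thesis
        using cone_partition_of_sdepth_quot_module[of "a (n - i) \<inter> b i" "a (n - i + 1) \<inter> b i" V c]
          False finite(2) i by (simp add: G_def)
    qed
    then obtain S where S: "\<And>i. i \<in> {..n} \<Longrightarrow> cone_partition V (S i) (G i)"
      "\<And>i p. i \<in> {..n} \<Longrightarrow> p \<in> S i \<Longrightarrow> c \<le> card (snd p)"
      by (metis atMost_iff)
    have part: "cone_partition V (\<Union>i\<le>n. S i) W"
      using cone_partition_UN[OF _ filtration(2)[OF b0] S(1)] filtration(1)[OF b0] by (simp add: W)
    have W_exps: "W \<subseteq> exps V"
      using a_exps by (auto simp: W)
    obtain D where D: "stanley_decomposition V (ideal_module V (mspan W :: 'k mpoly set)) D"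
      "set D = (\<lambda>(e, Z). (Poly_Mapping.single e 1, Z)) ` (\<Union>i\<le>n. S i)"
      using stanley_decomposition_of_cone_partition[OF part W_exps] by (elim exE conjE)
    have "(mspan W :: 'k mpoly set) \<noteq> {0}"
    proof (rule mspan_nonzero)
      show "W \<noteq> {}"
        using sum_sets_nonempty[of "E \<union> F" n] E(2) set_plus_intro[OF zero_in_exps] by (auto simp: W_def)
    qed
    then show ?thesis
      using S(2) by (intro sdepth_ge[OF abelian_group.axioms(1)[OF abelian_group_ideal_module] _ finite(2) D(1)])
        (auto simp: D(2))
  qed simp
  then show ?thesis
    unfolding Let_def XYV(3)[symmetric] prod sum c_def by (simp only: E(4) ideal_pow_mspan flip: ab)
qed

end
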